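(* Let $r,t$ be positive integers, $d=2^t+1$, $n=2^{t+1}$, and suppose $r\not\equiv 0\pmod{2^{t+1}}$. Then $wt(X(d,n+r))\neq 2^{n+r-2}$.
   Context: For integers $1\le d\le m$, $X(d,m)=\sum_{1\le i_1<i_2<\cdots<i_d\le m}x_{i_1}x_{i_2}\cdots x_{i_d}$ is the elementary symmetric polynomial of degree $d$ in $m$ variables over $GF(2)$, viewed as a function $GF(2)^m\to GF(2)$. For $f:GF(2)^m\to GF(2)$, $wt(f)$ is the number of $x\in GF(2)^m$ with $f(x)=1$. *)

theory Defs
  imports "HOL-Library.Z2" "HOL-Library.FuncSet" "HOL-Number_Theory.Cong"
begin

text \<open>
  \<^typ>\<open>bit\<close> is the field with two elements. A point of \<open>GF(2)\<^sup>m\<close> is an extensional function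
  on \<open>{1..m}\<close>, so that each point is represented exactly once and cardinalities are the
  intended ones.
\<close>

definition GF2_space :: "nat \<Rightarrow> (nat \<Rightarrow> bit) set" where
  "GF2_space m = {1..m} \<rightarrow>\<^sub>E UNIV"

text \<open>
  The index tuples \<open>1 \<le> i\<^sub>1 < \<dots> < i\<^sub>d \<le> m\<close> are identified with the \<open>d\<close>-element subsets of
  \<open>{1..m}\<close>.
\<close>

definition X :: "nat \<Rightarrow> nat \<Rightarrow> (nat \<Rightarrow> bit) \<Rightarrow> bit" where
  "X d m x = (\<Sum>I | I \<subseteq> {1..m} \<and> card I = d. \<Prod>i\<in>I. x i)"

text \<open>
  The dimension \<open>m\<close> of the domain of \<open>f\<close> is not determined by the type of \<open>f\<close> and is therefore
  an explicit argument.
\<close>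

definition wt :: "nat \<Rightarrow> ((nat \<Rightarrow> bit) \<Rightarrow> bit) \<Rightarrow> nat" where
  "wt m f = card {x \<in> GF2_space m. f x = 1}"

end

theory Submission
  imports Defs
begin

text \<open>
  At a point of Hamming weight \<open>w\<close> the function \<open>X d m\<close> takes the value \<open>w choose d\<close> modulo 2,
  and \<open>w choose (2^t + 1)\<close> is odd iff \<open>w\<close> and \<open>\<lfloor>w / 2^t\<rfloor>\<close> are odd. By Pascal's rule the claim
  thus becomes that the binomial transform at \<open>m - 1\<close> of the square wave
  \<open>\<sigma>(x) = (-1)^\<lfloor>x / 2^t\<rfloor>\<close> does not vanish. One step of the binomial transform adds
  two neighbouring values. In coordinates that follow the centre of the binomial distribution, the
  wave stays odd about its zeros, and it stays positive between two consecutive zeros by a discrete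
  maximum principle. So it vanishes only at those zeros, that is, only when \<open>2^(t+1)\<close> divides
  \<open>m\<close>.
\<close>

text \<open>Pascal's rule followed by an index shift. It drives both the recursion of
  \<open>wave_transform\<close> and the passage from \<open>Suc m\<close> to \<open>m\<close>
  variables in the weight.\<close>

lemma sum_choose_Suc:
  fixes F :: "nat \<Rightarrow> 'a :: comm_semiring_1"
  shows "(\<Sum>w\<le>Suc m. of_nat (Suc m choose w) * F w) =
         (\<Sum>w\<le>m. of_nat (m choose w) * (F w + F (Suc w)))"
proof -
  have "(\<Sum>w\<le>Suc m. of_nat (Suc m choose w) * F w) =
        F 0 + (\<Sum>w\<le>m. of_nat (m choose Suc w) * F (Suc w))
            + (\<Sum>w\<le>m. of_nat (m choose w) * F (Suc w))"
    by (subst sum.atMost_Suc_shift) (simp add: algebra_simps sum.distrib)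
  also have "F 0 + (\<Sum>w\<le>m. of_nat (m choose Suc w) * F (Suc w)) =
             (\<Sum>w\<le>m. of_nat (m choose w) * F w)"
    using sum.atMost_Suc_shift[of "\<lambda>w. of_nat (m choose w) * F w" m] by (simp add: binomial_eq_0)
  finally show ?thesis
    by (simp add: algebra_simps sum.distrib)
qed

subsection \<open>The binomial transform of a square wave\<close>

definition square_wave :: "int \<Rightarrow> int \<Rightarrow> int" where
  "square_wave M x = (if even (x div M) then 1 else -1)"

lemma square_wave_shift:
  "M > 0 \<Longrightarrow> square_wave M (x + M) = - square_wave M x"
  using div_add_self2[of M x] by (auto simp: square_wave_def)

text \<open>The map \<open>x\<close> to \<open>- 1 - x\<close> carries block \<open>q\<close> of
  length \<open>M\<close> onto block \<open>- 1 - q\<close>, which has the opposite parity.\<close>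

lemma square_wave_reflect:
  assumes "M > 0"
  shows "square_wave M (- 1 - x) = - square_wave M x"
proof -
  have "(- 1 - x) div M = - 1 - x div M"
  proof (rule int_div_pos_eq)
    show "- 1 - x = M * (- 1 - x div M) + (M - 1 - x mod M)"
      using mult_div_mod_eq[of M x] by (simp add: algebra_simps)
  qed (use assms pos_mod_sign[of M x] pos_mod_bound[of M x] in linarith)+
  then show ?thesis
    by (simp add: square_wave_def)
qed

text \<open>The free offset \<open>j\<close> closes the recursion in \<open>m\<close>, which
  involves two neighbouring offsets.\<close>

definition wave_transform :: "int \<Rightarrow> nat \<Rightarrow> int \<Rightarrow> int" where
  "wave_transform M m j = (\<Sum>w\<le>m. int (m choose w) * square_wave M (int w + j))"

lemma wave_transform_Suc:
  "wave_transform M (Suc m) j = wave_transform M m j + wave_transform M m (j + 1)"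
  unfolding wave_transform_def
  by (subst sum_choose_Suc) (simp add: algebra_simps sum.distrib)

lemma wave_transform_shift:
  assumes "M > 0"
  shows "wave_transform M m (j + M) = - wave_transform M m j"
  using square_wave_shift[OF assms, of "_ + j"]
  by (simp add: wave_transform_def sum_negf[symmetric] add.assoc)

lemma wave_transform_reflect:
  assumes "M > 0"
  shows "wave_transform M m (- 1 - int m - j) = - wave_transform M m j"
proof -
  have "wave_transform M m (- 1 - int m - j) =
        (\<Sum>w\<le>m. int (m choose (m - w)) * square_wave M (int (m - w) + (- 1 - int m - j)))"
    unfolding wave_transform_def
    by (rule sum.reindex_bij_witness[of _ "\<lambda>w. m - w" "\<lambda>w. m - w"]) auto
  also have "\<dots> = (\<Sum>w\<le>m. - (int (m choose w) * square_wave M (int w + j)))"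
  proof (rule sum.cong)
    fix w assume "w \<in> {..m}"
    then have centre: "int (m - w) + (- 1 - int m - j) = - 1 - (int w + j)"
      by auto
    from \<open>w \<in> {..m}\<close> show "int (m choose (m - w)) * square_wave M (int (m - w) + (- 1 - int m - j)) =
        - (int (m choose w) * square_wave M (int w + j))"
      unfolding centre square_wave_reflect[OF assms] by (simp add: binomial_symmetric[symmetric])
  qed simp
  finally show ?thesis
    by (simp add: wave_transform_def sum_negf)
qed

text \<open>For \<open>c = 2 * j + m + 1\<close>, reflection is \<open>c\<close> to
  \<open>- c\<close> and shifting adds \<open>2 * M\<close>; both flip the sign. At either value of
  \<open>c\<close> one reflection and an even number of shifts return to \<open>j\<close>, so the
  value equals its negative.\<close>

lemma wave_transform_zero:
  assumes "M > 0" and "2 * j + int m + 1 = 0 \<or> 2 * j + int m + 1 = 2 * M"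
  shows "wave_transform M m j = 0"
  using assms(2)
proof
  assume "2 * j + int m + 1 = 0"
  then have "- 1 - int m - j = j" by simp
  then show ?thesis
    using wave_transform_reflect[OF assms(1), of m j] by simp
next
  assume "2 * j + int m + 1 = 2 * M"
  then have "- 1 - int m - j = j - M - M" by simp
  then show ?thesis
    using wave_transform_reflect[OF assms(1), of m j]
      wave_transform_shift[OF assms(1), of m "j - M - M"]
      wave_transform_shift[OF assms(1), of m "j - M"] by simp
qed

text \<open>
  The quantity \<open>2 * j + m + 1\<close> is twice the distance of the centre \<open>j + m / 2\<close> from the zero
  \<open>- 1 / 2\<close> of the wave.
\<close>
lemma wave_transform_pos:
  assumes "M \<ge> 2" and "0 < 2 * j + int m + 1" and "2 * j + int m + 1 < 2 * M"
  shows "wave_transform M m j > 0"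
  using assms(2,3)
proof (induction m arbitrary: j)
  case 0
  then have "j div M = 0" by simp
  then show ?case by (simp add: wave_transform_def square_wave_def)
next
  case (Suc m)
  \<comment> \<open>The two summands have centre coordinates one below and one above the current
    one, so each lies inside the interval or at an end, where the transform is zero.\<close>
  have left: "wave_transform M m j \<ge> 0"
    using Suc.IH[of j] wave_transform_zero[of M j m] assms(1) Suc.prems by fastforce
  have right: "wave_transform M m (j + 1) \<ge> 0"
    using Suc.IH[of "j + 1"] wave_transform_zero[of M "j + 1" m] assms(1) Suc.prems by fastforce
  \<comment> \<open>Both summands at the ends would force \<open>2 * M = 2\<close>, contrary to
    \<open>M \<ge> 2\<close>.\<close>
  have "wave_transform M m j > 0 \<or> wave_transform M m (j + 1) > 0"
    using Suc.IH[of j] Suc.IH[of "j + 1"] assms(1) Suc.prems by fastforce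
  then show ?case
    using left right by (auto simp: wave_transform_Suc)
qed

text \<open>Shifts by \<open>M\<close> preserve vanishing, so the centre coordinate
  \<open>m + 1\<close> may be reduced modulo \<open>2 * M\<close>, landing strictly between two
  zeros.\<close>

lemma wave_transform_nonzero:
  assumes "M \<ge> 2" and "\<not> 2 * M dvd int m + 1"
  shows "wave_transform M m 0 \<noteq> 0"
proof -
  have periodic: "wave_transform M m (- (int k * M)) = 0" if "wave_transform M m 0 = 0" for k
  proof (induction k)
    case (Suc k)
    then show ?case
      using wave_transform_shift[of M m "- (int (Suc k) * M)"] assms(1)
      by (simp add: algebra_simps)
  qed (use that in simp)
  define k where "k = nat ((int m + 1) div (2 * M))"
  have k: "int k = (int m + 1) div (2 * M)"
    using assms(1) by (simp add: k_def div_int_pos_iff)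
  have "2 * (- (int k * M)) + int m + 1 = (int m + 1) mod (2 * M)"
    using mult_div_mod_eq[of "2 * M" "int m + 1"] by (simp add: k algebra_simps)
  moreover have "(int m + 1) mod (2 * M) > 0" "(int m + 1) mod (2 * M) < 2 * M"
    using assms pos_mod_sign[of "2 * M" "int m + 1"] pos_mod_bound[of "2 * M" "int m + 1"]
    by (auto simp: dvd_eq_mod_eq_0 order_less_le)
  ultimately have "wave_transform M m (- (int k * M)) > 0"
    using wave_transform_pos[OF assms(1), of "- (int k * M)" m] by simp
  with periodic show ?thesis by fastforce
qed

subsection \<open>Parity of binomial coefficients\<close>

text \<open>By absorption \<open>2 ^ t\<close> divides \<open>k * (2 ^ t choose k)\<close>; an odd
  coefficient would leave \<open>2 ^ t dvd k\<close>.\<close>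

lemma even_choose_power_of_two:
  assumes "0 < k" and "k < 2 ^ t"
  shows "even (2 ^ t choose k)"
proof (rule ccontr)
  assume "odd (2 ^ t choose k)"
  then have "coprime (2 ^ t) (2 ^ t choose k)" by simp
  moreover have "2 ^ t dvd k * (2 ^ t choose k)"
    using times_binomial_minus1_eq[OF assms(1), of "2 ^ t"] by simp
  ultimately have "2 ^ t dvd k"
    using coprime_dvd_mult_left_iff by blast
  with assms show False by (auto dest: dvd_imp_le)
qed

text \<open>Modulo 2 only the two extreme terms of Vandermonde's sum survive.\<close>

lemma odd_add_power_choose_power_of_two:
  "odd ((w + 2 ^ t) choose 2 ^ t) \<longleftrightarrow> even (w choose 2 ^ t)"
proof -
  let ?f = "\<lambda>k. (2 ^ t choose k) * (w choose (2 ^ t - k))"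
  have "(w + 2 ^ t) choose 2 ^ t = (\<Sum>k\<le>2 ^ t. ?f k)"
    by (metis vandermonde add.commute)
  also have "\<dots> = (\<Sum>k\<in>{0, 2 ^ t}. ?f k) + (\<Sum>k\<in>{..2 ^ t} - {0, 2 ^ t}. ?f k)"
    by (subst add.commute, rule sum.subset_diff) auto
  finally have "(w + 2 ^ t) choose 2 ^ t =
      (w choose 2 ^ t) + 1 + (\<Sum>k\<in>{..2 ^ t} - {0, 2 ^ t}. ?f k)"
    by simp
  moreover have "even (\<Sum>k\<in>{..2 ^ t} - {0, 2 ^ t}. ?f k)"
    by (rule dvd_sum) (use even_choose_power_of_two in auto)
  ultimately show ?thesis by simp
qed

lemma odd_choose_power_of_two:
  "odd (w choose 2 ^ t) \<longleftrightarrow> odd (w div 2 ^ t)"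
proof (induction w rule: less_induct)
  case (less w)
  show ?case
  proof (cases "w < 2 ^ t")
    case False
    then obtain v where w: "w = v + 2 ^ t"
      by (metis add.commute le_add_diff_inverse not_less)
    then show ?thesis
      using less.IH[of v] div_add_self2[of "2 ^ t" v] by (simp add: odd_add_power_choose_power_of_two)
  qed (simp add: binomial_eq_0)
qed

text \<open>Absorption reduces to \<open>w choose 2 ^ t\<close>: the factor \<open>2 ^ t + 1\<close>
  is odd, and \<open>w - 2 ^ t\<close> has the parity of \<open>w\<close>.\<close>

lemma odd_choose_Suc_power_of_two:
  assumes "t > 0"
  shows "odd (w choose (2 ^ t + 1)) \<longleftrightarrow> odd w \<and> odd (w div 2 ^ t)"
proof (cases "w < 2 ^ t")
  case False
  have "(2 ^ t + 1) * (w choose (2 ^ t + 1)) = (w - 2 ^ t) * (w choose 2 ^ t)"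
    using binomial_absorb_comp[of w "2 ^ t"] binomial_absorption[of "2 ^ t" "w"]  by simp
  then have "odd (w choose (2 ^ t + 1)) \<longleftrightarrow> odd (w - 2 ^ t) \<and> odd (w choose 2 ^ t)"
    using assms by (metis even_mult_iff even_plus_one_iff even_power even_numeral zero_less_power)
  with False assms show ?thesis
    by (simp add: odd_choose_power_of_two)
qed (simp add: binomial_eq_0)

subsection \<open>The weight of an elementary symmetric function\<close>

lemma of_nat_bit_eq_1_iff: "(of_nat k :: bit) = 1 \<longleftrightarrow> odd k"
  by (induction k) auto

text \<open>A monomial is 1 exactly when its index set lies in the support of
  \<open>x\<close>.\<close>

lemma X_eq_of_nat_choose:
  "X d m x = of_nat (card {i \<in> {1..m}. x i = 1} choose d)"
proof -
  let ?S = "{i \<in> {1..m}. x i = 1}"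
  have prod: "(\<Prod>i\<in>I. x i) = of_bool (I \<subseteq> ?S)" if "I \<subseteq> {1..m}" for I
  proof (cases "I \<subseteq> ?S")
    case True
    then show ?thesis by (auto intro!: prod.neutral)
  next
    case False
    then obtain i where "i \<in> I" "i \<notin> ?S" by blast
    moreover from this that have "x i = 0" by auto
    moreover have "finite I" using that finite_subset by blast
    ultimately show ?thesis using False by (auto simp: prod_zero_iff)
  qed
  have "X d m x = (\<Sum>I | I \<subseteq> {1..m} \<and> card I = d. of_bool (I \<subseteq> ?S))"
    unfolding X_def by (rule sum.cong) (use prod in auto)
  also have "\<dots> = of_nat (card ({I. I \<subseteq> {1..m} \<and> card I = d} \<inter> {I. I \<subseteq> ?S}))"
    by (subst sum_of_bool_eq) (auto simp: finite_subset)
  also have "{I. I \<subseteq> {1..m} \<and> card I = d} \<inter> {I. I \<subseteq> ?S} = {I. I \<subseteq> ?S \<and> card I = d}"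
    by auto
  also have "card \<dots> = card ?S choose d"
    by (rule n_subsets) simp
  finally show ?thesis .
qed

lemma bij_betw_support_GF2_space:
  "bij_betw (\<lambda>x. {i \<in> {1..m}. x i = 1}) (GF2_space m) (Pow {1..m})"
proof (rule bij_betw_byWitness)
  let ?g = "\<lambda>A. \<lambda>i\<in>{1..m}. of_bool (i \<in> A) :: bit"
  show "\<forall>x\<in>GF2_space m. ?g {i \<in> {1..m}. x i = 1} = x"
    by (auto simp: GF2_space_def PiE_def extensional_def fun_eq_iff)
  show "\<forall>A\<in>Pow {1..m}. {i \<in> {1..m}. ?g A i = 1} = A"
    by (auto split: if_splits)
  show "?g ` Pow {1..m} \<subseteq> GF2_space m"
    by (auto simp: GF2_space_def)
qed auto

lemma wt_X:
  "wt m (X d m) = (\<Sum>w\<le>m. (m choose w) * of_bool (odd (w choose d)))"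
proof -
  let ?S = "\<lambda>x. {i \<in> {1..m}. x i = (1 :: bit)}"
  let ?P = "\<lambda>A. odd (card A choose d)"
  have "wt m (X d m) = card {x \<in> GF2_space m. ?P (?S x)}"
    by (simp add: wt_def X_eq_of_nat_choose of_nat_bit_eq_1_iff)
  also have "\<dots> = card {A \<in> Pow {1..m}. ?P A}"
  proof (rule bij_betw_same_card)
    show "bij_betw ?S {x \<in> GF2_space m. ?P (?S x)} {A \<in> Pow {1..m}. ?P A}"
      using bij_betw_support_GF2_space[of m]
      by (rule bij_betw_Collect) simp
  qed
  also have "\<dots> = (\<Sum>A\<in>Pow {1..m}. of_bool (?P A))"
    by (simp add: sum_of_bool_eq Int_def)
  also have "\<dots> = (\<Sum>w\<le>m. \<Sum>A\<in>{A \<in> Pow {1..m}. card A = w}. of_bool (?P A))"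
  proof (rule sum.group[symmetric])
    show "card ` Pow {1..m} \<subseteq> {..m}"
      using card_mono[of "{1..m}"] by auto
  qed auto
  also have "\<dots> = (\<Sum>w\<le>m. (m choose w) * of_bool (odd (w choose d)))"
  proof (rule sum.cong)
    fix w
    have "card {A \<in> Pow {1..m}. card A = w} = m choose w"
      using n_subsets[of "{1..m}" w] by simp
    then show "(\<Sum>A\<in>{A \<in> Pow {1..m}. card A = w}. of_bool (?P A)) =
        (m choose w) * of_bool (odd (w choose d))"
      by simp
  qed simp
  finally show ?thesis .
qed

lemma wt_X_Suc_power_of_two:
  assumes "t > 0"
  shows "2 * int (wt (Suc m) (X (2 ^ t + 1) (Suc m))) = 2 ^ m - wave_transform (2 ^ t) m 0"
proof -
  let ?F = "\<lambda>w. of_bool (odd w \<and> odd (w div 2 ^ t)) :: nat"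
  \<comment> \<open>Exactly one of \<open>w\<close>, \<open>Suc w\<close> is odd; if it is
    \<open>Suc w\<close>, both lie in the same block because \<open>2 ^ t\<close> is even.\<close>
  have F: "?F w + ?F (Suc w) = of_bool (odd (w div 2 ^ t))" for w
  proof (cases "even w")
    case True
    have "Suc w div 2 ^ t = w div 2 ^ t"
      using True assms by (cases t) (simp_all add: div_mult2_eq)
    with True show ?thesis by simp
  qed simp
  have "wt (Suc m) (X (2 ^ t + 1) (Suc m)) = (\<Sum>w\<le>Suc m. of_nat (Suc m choose w) * ?F w)"
    by (simp only: wt_X odd_choose_Suc_power_of_two[OF assms] of_nat_id)
  also have "\<dots> = (\<Sum>w\<le>m. (m choose w) * of_bool (odd (w div 2 ^ t)))"
    using sum_choose_Suc[of m ?F] by (simp only: F of_nat_id)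
  finally have "2 * int (wt (Suc m) (X (2 ^ t + 1) (Suc m))) =
      (\<Sum>w\<le>m. int (m choose w) * (2 * of_bool (odd (w div 2 ^ t))))"
    by (simp only: of_nat_sum of_nat_mult of_nat_of_bool sum_distrib_left mult.left_commute)
  also have "\<dots> = (\<Sum>w\<le>m. int (m choose w) * (1 - square_wave (2 ^ t) (int w + 0)))"
  proof (rule sum.cong)
    fix w
    have "int w div 2 ^ t = int (w div 2 ^ t)"
      by (simp add: zdiv_int)
    then show "int (m choose w) * (2 * of_bool (odd (w div 2 ^ t))) =
        int (m choose w) * (1 - square_wave (2 ^ t) (int w + 0))"
      by (simp add: square_wave_def)
  qed simp
  also have "\<dots> = int (\<Sum>w\<le>m. m choose w) - wave_transform (2 ^ t) m 0"
    by (simp add: wave_transform_def algebra_simps sum_subtractf)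
  finally show ?thesis
    by (simp add: choose_row_sum)
qed

theorem lemma20:
  fixes r t d n :: nat
  assumes "r > 0" and "t > 0"
    and "d = 2 ^ t + 1" and "n = 2 ^ (t + 1)"
    and "\<not> [r = 0] (mod 2 ^ (t + 1))"
  shows "wt (n + r) (X d (n + r)) \<noteq> 2 ^ (n + r - 2)"
proof
  assume balanced: "wt (n + r) (X d (n + r)) = 2 ^ (n + r - 2)"
  \<comment> \<open>This makes the truncated exponent \<open>n + r - 2\<close> a genuine
    difference.\<close>
  have "n \<ge> 2" using assms(4) by simp
  then obtain m where m: "n + r = Suc (Suc m)"
    by (metis add_2_eq_Suc le_Suc_ex trans_le_add1)
  have "2 * int (2 ^ m) = 2 ^ Suc m - wave_transform (2 ^ t) (Suc m) 0"
    using wt_X_Suc_power_of_two[OF assms(2), of "Suc m"] balanced assms(3) m by simp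
  then have "wave_transform (2 ^ t) (Suc m) 0 = 0" by simp
  moreover have "(2 :: int) \<le> 2 ^ t"
    using assms(2) self_le_power[of "2 :: int" t] by simp
  \<comment> \<open>Since \<open>n\<close> is the full period \<open>2 ^ (t + 1)\<close>,
    divisibility of \<open>n + r\<close> amounts to that of \<open>r\<close>.\<close>
  moreover have "\<not> 2 * 2 ^ t dvd int (Suc m) + 1"
  proof -
    have "\<not> 2 ^ (t + 1) dvd n + r"
      using assms(4,5) by (simp add: cong_0_iff)
    then have "\<not> int (2 ^ (t + 1)) dvd int (n + r)"
      by (simp only: int_dvd_int_iff not_False_eq_True)
    then show ?thesis by (simp add: m add_ac)
  qed
  ultimately show False
    using wave_transform_nonzero by blast
qed

end
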